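(* Let $f\colon\mathbf{R}^2\to\mathbf{R}$ be an asymptotically constant $C^2$ function. Then for every pair of directions $X,Y\in\mathbf{S}^1$, $$\lim_{r\to\infty}\int_{p\in B_r}\big(k(p,X)-k(p,Y)\big)\left(1+f_X^2(p)\right)\left(1+f_Y^2(p)\right)\,d\mathcal{A}_p=0.$$ In particular, the function $k(\,\cdot\,,X)-k(\,\cdot\,,Y)$ is either identically zero or else changes sign on $\mathbf{R}^2$.
   Context: A function $f\colon\mathbf{R}^2\to\mathbf{R}$ is asymptotically constant if, in polar coordinates $(r,\theta)$, $$\lim_{r\to\infty}f(r,\theta)=\text{const.}\quad\text{and}\quad\lim_{r\to\infty}r\,\|\nabla f(r,\theta)\|=0,$$ both uniformly with respect to $\theta$ (the constant does not depend on $\theta$). $\mathbf{S}^1\subset\mathbf{R}^2$ is the unit circle, whose elements are called directions. For $X\in\mathbf{S}^1$, $f_X:=\langle\nabla f,X\rangle$ is the derivative of $f$ in the direction $X$, $f_{XX}:=(f_X)_X$, and $f_X^2$ denotes $(f_X)^2$. For $p\in\mathbf{R}^2$ and $X\in\mathbf{S}^1$, $$k(p,X):=\frac{f_{XX}(p)}{\left(1+f_X^2(p)\right)\sqrt{1+\|\nabla f(p)\|^2}},$$ which is the normal curvature of the graph of $f$ at $(p,f(p))$ in the direction of a tangent vector whose projection into $\mathbf{R}^2$ is parallel to $X$. $B_r$ is the closed ball of radius $r$ centered at the origin of $\mathbf{R}^2$, and $d\mathcal{A}_p:=\sqrt{1+\|\nabla f(p)\|^2}\,dx\wedge dy$ is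 the area element of the graph of $f$. A function changes sign on $\mathbf{R}^2$ if it takes both a positive and a negative value. *)

theory Defs
  imports "HOL-Analysis.Analysis"
begin

definition grad :: "(real^2 \<Rightarrow> real) \<Rightarrow> real^2 \<Rightarrow> real^2" where
  "grad f p = (THE D. GDERIV f p :> D)"

lemma grad_eqI:
  assumes "GDERIV f p :> D"
  shows "grad f p = D"
  unfolding grad_def
proof (rule the_equality)
  show "GDERIV f p :> D" by fact
next
  fix D' assume "GDERIV f p :> D'"
  with assms have "(\<lambda>h. h \<bullet> D') = (\<lambda>h. h \<bullet> D)"
    unfolding gderiv_def by (rule has_derivative_unique[rotated])
  then show "D' = D"
    by (metis vector_eq_rdot inner_commute)
qed

lemma GDERIV_grad:
  assumes "f differentiable (at p)"
  shows "GDERIV f p :> grad f p"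
proof -
  obtain f' where f': "(f has_derivative f') (at p)"
    using assms by (auto simp: differentiable_def)
  have "f' = (\<lambda>h. h \<bullet> adjoint f' 1)"
    using adjoint_works[OF has_derivative_linear[OF f']] by (auto simp: fun_eq_iff)
  with f' have "GDERIV f p :> adjoint f' 1"
    unfolding gderiv_def by metis
  then show ?thesis
    using grad_eqI by metis
qed

definition C1 :: "(real^2 \<Rightarrow> real) \<Rightarrow> bool" where
  "C1 f \<longleftrightarrow> (\<forall>p. f differentiable (at p)) \<and> continuous_on UNIV (grad f)"

definition C2 :: "(real^2 \<Rightarrow> real) \<Rightarrow> bool" where
  "C2 f \<longleftrightarrow> C1 f \<and> (\<forall>i. C1 (\<lambda>p. grad f p $ i))"

definition polar :: "real \<Rightarrow> real \<Rightarrow> real^2" where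
  "polar r \<theta> = vector [r * cos \<theta>, r * sin \<theta>]"

definition asymptotically_constant :: "(real^2 \<Rightarrow> real) \<Rightarrow> bool" where
  "asymptotically_constant f \<longleftrightarrow>
     (\<exists>c. uniform_limit UNIV (\<lambda>r \<theta>. f (polar r \<theta>)) (\<lambda>_. c) at_top) \<and>
     uniform_limit UNIV (\<lambda>r \<theta>. r * norm (grad f (polar r \<theta>))) (\<lambda>_. 0) at_top"

definition dir_deriv :: "real^2 \<Rightarrow> (real^2 \<Rightarrow> real) \<Rightarrow> real^2 \<Rightarrow> real" where
  "dir_deriv X f p = grad f p \<bullet> X"

text \<open>Normal curvature of the graph of \<open>f\<close> at \<open>(p, f p)\<close>, in the tangent direction
  projecting to \<open>X\<close>.\<close>

definition normal_curvature :: "(real^2 \<Rightarrow> real) \<Rightarrow> real^2 \<Rightarrow> real^2 \<Rightarrow> real" where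
  "normal_curvature f p X =
     dir_deriv X (dir_deriv X f) p /
       ((1 + (dir_deriv X f p)\<^sup>2) * sqrt (1 + (norm (grad f p))\<^sup>2))"

text \<open>The area measure of the graph of \<open>f\<close>, transported to the plane by vertical projection.\<close>

definition graph_area :: "(real^2 \<Rightarrow> real) \<Rightarrow> (real^2) measure" where
  "graph_area f = density lborel (\<lambda>p. ennreal (sqrt (1 + (norm (grad f p))\<^sup>2)))"

definition changes_sign :: "(real^2 \<Rightarrow> real) \<Rightarrow> bool" where
  "changes_sign g \<longleftrightarrow> (\<exists>p. g p > 0) \<and> (\<exists>p. g p < 0)"

end

theory Submission
  imports Defs
begin

text \<open>
  Multiplying the difference of the normal curvatures by the weight
  \<open>(1 + f\<^sub>X\<^sup>2) (1 + f\<^sub>Y\<^sup>2)\<close> and by the area density clears all denominators and leaves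
  \<open>f\<^sub>X\<^sub>X (1 + f\<^sub>Y\<^sup>2) - f\<^sub>Y\<^sub>Y (1 + f\<^sub>X\<^sup>2)\<close>. This is a divergence: it is the derivative of
  \<open>f\<^sub>X (1 + f\<^sub>Y\<^sup>2)\<close> in the direction \<open>X\<close> minus the derivative of \<open>f\<^sub>Y (1 + f\<^sub>X\<^sup>2)\<close> in the
  direction \<open>Y\<close>, since the two mixed terms \<open>2 f\<^sub>X f\<^sub>Y f\<^sub>X\<^sub>Y\<close> cancel by the symmetry of second
  derivatives (\<open>curvature_difference_eq_divergence\<close>). Its integral over the disc of radius \<open>r\<close> is
  therefore a flux through a circle of length \<open>2 \<pi> r\<close>, and the flux density is of the order of the
  gradient of \<open>f\<close>, which is \<open>o(1 / r)\<close>. So the integral tends to \<open>0\<close>.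

  Only an upper bound for the flux matters, and translation invariance of Lebesgue measure
  supplies one without a divergence theorem. The integral of a difference quotient
  \<open>(g (p + h X) - g p) / h\<close> over a ball compares the integrals of \<open>g\<close> over two balls whose
  centres are \<open>h\<close> apart. They differ only inside an annulus of width \<open>2 h\<close> around the sphere, so
  the volume of the annulus divided by \<open>h\<close> stays bounded as \<open>h\<close> tends to \<open>0\<close>
  (\<open>integral_directional_derivative_cball_le\<close>).

  For the last claim, suppose that the difference of the curvatures does not change sign. Then the
  weighted difference has a constant sign too, its integrals over growing discs are monotone and
  tend to \<open>0\<close>, so all of them vanish, and by continuity the integrand vanishes everywhere.
\<close>

section \<open>Integrating a directional derivative over a ball\<close>

text \<open>
  The factor of \<open>M\<close> is twice the surface area of the sphere of radius \<open>r\<close>; the Gauss theorem would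
  give the same bound without the factor \<open>2\<close>, which comes from replacing the symmetric difference
  of two balls a distance \<open>h\<close> apart by a full annulus of width \<open>2 h\<close>. Taking \<open>s < r\<close> lets \<open>M\<close> bound
  \<open>g\<close> on all thin annuli around the sphere, not only on the sphere they shrink to.
\<close>

lemma integral_directional_derivative_cball_le:
  fixes g g' :: "'a::euclidean_space \<Rightarrow> real"
  assumes deriv: "\<And>p t. ((\<lambda>t. g (p + t *\<^sub>R X)) has_real_derivative g' (p + t *\<^sub>R X)) (at t)"
    and cont: "continuous_on UNIV g" and cont': "continuous_on UNIV g'"
    and X: "norm X \<le> 1"
    and s: "0 \<le> s" "s < r" and M: "\<And>p. s \<le> norm p \<Longrightarrow> \<bar>g p\<bar> \<le> M"
  shows "\<bar>LINT p:cball 0 r|lborel. g' p\<bar> \<le> M * (2 * DIM('a) * unit_ball_vol DIM('a) * r ^ (DIM('a) - 1))"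
proof -
  define n where "n = DIM('a)"
  define V where "V = unit_ball_vol (real n)"
  define B where "B = (cball 0 r :: 'a set)"
  define h where "h k = inverse (real (Suc k))" for k
  define a where "a k = (LINT p:B|lborel. (g (p + h k *\<^sub>R X) - g p) / h k)" for k
  have h_pos: "h k > 0" and h_le: "h k \<le> 1" for k
    by (auto simp: h_def field_simps)
  have h_lim: "h \<longlonglongrightarrow> 0"
    unfolding h_def by (rule LIMSEQ_inverse_real_of_nat)
  have meas[measurable]: "g \<in> borel_measurable borel" "g' \<in> borel_measurable borel"
    using cont cont' by (auto intro: borel_measurable_continuous_onI)
  have B_meas[measurable]: "B \<in> sets borel" by (simp add: B_def)
  have int: "integrable lborel (\<lambda>p. indicator B p * F p)" if "continuous_on UNIV F" for F :: "'a \<Rightarrow> real"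
    using borel_integrable_compact[of B F] continuous_on_subset[OF that, of B]
    by (simp add: B_def)
  \<comment> \<open>Shifting the variable turns the integral of the difference quotient into an integral of \<open>g\<close>
    over the symmetric difference of two balls, which lies in the annulus \<open>A\<close>.\<close>
  have bound: "\<bar>a k\<bar> \<le> M * V * (((r + h k) ^ n - (r - h k) ^ n) / h k)" if "h k < r - s" for k
  proof -
    define c where "c = h k *\<^sub>R X"
    have norm_c: "norm c \<le> h k"
      using X h_pos[of k] by (simp add: c_def mult_left_le)
    define A where "A = cball (0::'a) (r + h k) - ball 0 (r - h k)"
    have shift: "continuous_on UNIV (\<lambda>p. g (p + c))"
      by (intro continuous_on_compose2[OF cont] continuous_intros) auto
    let ?F = "\<lambda>p. indicator B (p - c) * g p"
    have F_meas: "?F \<in> borel_measurable borel" by measurable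
    have trans: "(LINT p|lborel. indicator B p * g (p + c)) = (LINT p|lborel. ?F p)"
    proof -
      have "(LINT p|lborel. ?F p) = (LINT p|distr lborel borel ((+) c). ?F p)"
        by (simp add: lborel_distr_plus)
      also have "\<dots> = (LINT p|lborel. ?F (c + p))"
        by (rule integral_distr) (use F_meas in auto)
      finally show ?thesis by (simp add: add.commute)
    qed
    have F_int: "integrable lborel ?F"
    proof -
      have "integrable lborel (\<lambda>p. ?F (c + p))"
        using int[OF shift] by (simp add: add.commute)
      then have "integrable (distr lborel borel ((+) c)) ?F"
        by (subst integrable_distr_eq) (use F_meas in auto)
      then show ?thesis by (simp add: lborel_distr_plus)
    qed
    have "a k * h k = (LINT p|lborel. indicator B p * ((g (p + c) - g p) / h k) * h k)"
      by (simp add: a_def c_def set_lebesgue_integral_def)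
    also have "\<dots> = (LINT p|lborel. indicator B p * g (p + c) - indicator B p * g p)"
      using h_pos[of k] by (intro Bochner_Integration.integral_cong) (simp_all add: right_diff_distrib)
    also have "\<dots> = (LINT p|lborel. indicator B p * g (p + c)) - (LINT p|lborel. indicator B p * g p)"
      by (rule Bochner_Integration.integral_diff) (rule int shift cont)+
    also have "\<dots> = (LINT p|lborel. ?F p - indicator B p * g p)"
      unfolding trans by (rule Bochner_Integration.integral_diff[symmetric]) (rule int cont F_int)+
    finally have ah: "a k * h k = (LINT p|lborel. ?F p - indicator B p * g p)" .
    have emA: "emeasure lborel A = ennreal (V * ((r + h k) ^ n - (r - h k) ^ n))"
    proof -
      have "emeasure lborel A = emeasure lborel (cball (0::'a) (r + h k)) - emeasure lborel (ball (0::'a) (r - h k))"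
        unfolding A_def
        using emeasure_lborel_ball_finite[of "0::'a" "r - h k"] h_pos[of k]
        by (intro emeasure_Diff subset_trans[OF ball_subset_cball] subset_cball) auto
      also have "\<dots> = ennreal (V * (r + h k) ^ n) - ennreal (V * (r - h k) ^ n)"
        using h_pos[of k] that s by (simp add: emeasure_cball emeasure_ball V_def n_def)
      also have "\<dots> = ennreal (V * ((r + h k) ^ n - (r - h k) ^ n))"
        using that s by (subst ennreal_minus) (auto simp: V_def algebra_simps)
      finally show ?thesis .
    qed
    have A_int: "integrable lborel (\<lambda>p. M * indicator A p)"
      using emA by (auto intro!: integrable_mult_right integrable_real_indicator simp: A_def)
    have "\<bar>a k * h k\<bar> \<le> (LINT p|lborel. M * indicator A p)"
      unfolding ah
    proof (rule Bochner_Integration.integral_abs_bound_integral)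
      show "integrable lborel (\<lambda>p. ?F p - indicator B p * g p)"
        by (intro Bochner_Integration.integrable_diff int cont F_int)
      show "integrable lborel (\<lambda>p. M * indicator A p)" by fact
      fix p :: 'a
      have M0: "0 \<le> M"
        using M s(1) by (metis abs_ge_zero order_refl order_trans vector_choose_size)
      have *: "norm (p - c) \<le> norm p + h k" "norm p \<le> norm (p - c) + h k"
        using norm_c norm_triangle_ineq4[of p c] norm_triangle_ineq[of "p - c" c] by auto
      show "\<bar>?F p - indicator B p * g p\<bar> \<le> M * indicator A p"
      proof (cases "p \<in> A")
        case True
        then have "\<bar>g p\<bar> \<le> M" using that by (intro M) (auto simp: A_def)
        with True M0 show ?thesis by (auto simp: indicator_def)
      next
        case False
        then have "p - c \<in> B \<longleftrightarrow> p \<in> B"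
          using * h_pos[of k] by (auto simp: A_def B_def)
        with False show ?thesis by (simp add: indicator_def)
      qed
    qed
    also have "\<dots> = M * (V * ((r + h k) ^ n - (r - h k) ^ n))"
    proof -
      have "measure lborel A = V * ((r + h k) ^ n - (r - h k) ^ n)"
        using emA s that h_pos[of k] unfolding measure_def
        by (simp add: V_def power_mono)
      then show ?thesis by simp
    qed
    finally show ?thesis
      using h_pos[of k] by (simp add: abs_mult field_simps)
  qed
  have a_lim: "a \<longlonglongrightarrow> (LINT p:B|lborel. g' p)"
  proof -
    have "compact (cball (0::'a) (r + 1))" by simp
    then have "bounded (g' ` cball 0 (r + 1))"
      by (intro compact_imp_bounded compact_continuous_image continuous_on_subset[OF cont']) auto
    then obtain K where K: "\<And>p. norm p \<le> r + 1 \<Longrightarrow> \<bar>g' p\<bar> \<le> K"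
      unfolding bounded_iff by (metis image_eqI mem_cball_0 real_norm_def)
    show ?thesis
      unfolding a_def set_lebesgue_integral_def real_scaleR_def
    proof (rule integral_dominated_convergence[where w = "\<lambda>p. indicator B p * K"])
      show "integrable lborel (\<lambda>p. indicator B p * K)" by (rule int) simp
      show "AE p in lborel. (\<lambda>k. indicator B p * ((g (p + h k *\<^sub>R X) - g p) / h k)) \<longlonglongrightarrow> indicator B p * g' p"
      proof (rule AE_I2, rule tendsto_mult_left)
        fix p :: 'a
        have "((\<lambda>t. (g (p + t *\<^sub>R X) - g p) / t) \<longlongrightarrow> g' p) (at 0)"
          using deriv[of p 0] by (simp add: DERIV_def)
        moreover have "filterlim h (at 0) sequentially"
          unfolding filterlim_at using h_lim h_pos by (auto simp: less_imp_neq[symmetric] intro!: always_eventually)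
        ultimately show "(\<lambda>k. (g (p + h k *\<^sub>R X) - g p) / h k) \<longlonglongrightarrow> g' p"
          by (rule filterlim_compose)
      qed
      show "AE p in lborel. norm (indicator B p * ((g (p + h k *\<^sub>R X) - g p) / h k)) \<le> indicator B p * K" for k
      proof (rule AE_I2)
        fix p :: 'a
        have "\<bar>g (p + h k *\<^sub>R X) - g p\<bar> \<le> K * h k" if "p \<in> B"
        proof -
          obtain z where z: "0 < z" "z < h k"
              "g (p + h k *\<^sub>R X) - g (p + 0 *\<^sub>R X) = (h k - 0) * g' (p + z *\<^sub>R X)"
            using MVT2[OF h_pos[of k] deriv] by blast
          have "norm (z *\<^sub>R X) \<le> 1"
            using z X h_le[of k] by (simp add: mult_le_one)
          then have "norm (p + z *\<^sub>R X) \<le> r + 1"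
            using that norm_triangle_ineq[of p "z *\<^sub>R X"] by (simp add: B_def)
          from K[OF this] z h_pos[of k] show ?thesis
            by (simp add: abs_mult mult.commute)
        qed
        then show "norm (indicator B p * ((g (p + h k *\<^sub>R X) - g p) / h k)) \<le> indicator B p * K"
          using h_pos[of k] by (auto simp: indicator_def field_simps)
      qed
    qed measurable
  qed
  \<comment> \<open>Up to the factor \<open>2 * V\<close>, this is the symmetric difference quotient of \<open>r ^ n\<close>.\<close>
  have bound_lim: "(\<lambda>k. M * V * (((r + h k) ^ n - (r - h k) ^ n) / h k))
      \<longlonglongrightarrow> M * V * (2 * n * r ^ (n - 1))"
  proof (rule tendsto_mult_left)
    have "((\<lambda>t. (r + t) ^ n - (r - t) ^ n) has_real_derivative 2 * n * r ^ (n - 1)) (at 0)"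
      by (auto intro!: derivative_eq_intros simp: algebra_simps)
    then have "((\<lambda>t. ((r + t) ^ n - (r - t) ^ n) / t) \<longlongrightarrow> 2 * n * r ^ (n - 1)) (at 0)"
      by (simp add: DERIV_def)
    moreover have "filterlim h (at 0) sequentially"
      unfolding filterlim_at using h_lim h_pos by (auto simp: less_imp_neq[symmetric] intro!: always_eventually)
    ultimately show "(\<lambda>k. ((r + h k) ^ n - (r - h k) ^ n) / h k) \<longlonglongrightarrow> 2 * n * r ^ (n - 1)"
      by (rule filterlim_compose)
  qed
  have "\<forall>\<^sub>F k in sequentially. h k < r - s"
    using s by (intro order_tendstoD(2)[OF h_lim]) auto
  then have "\<forall>\<^sub>F k in sequentially. \<bar>a k\<bar> \<le> M * V * (((r + h k) ^ n - (r - h k) ^ n) / h k)"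
    by eventually_elim (rule bound)
  from tendsto_le[OF _ bound_lim tendsto_rabs[OF a_lim] this]
  show ?thesis by (simp add: B_def V_def n_def mult_ac)
qed

text \<open>
  The sphere of radius \<open>r\<close> has area proportional to \<open>r ^ (DIM('a) - 1)\<close>, so this rate of decay is
  exactly what makes the flux through it vanish in the limit.
\<close>

lemma integral_directional_derivative_cball_tendsto_0:
  fixes g g' :: "'a::euclidean_space \<Rightarrow> real"
  assumes deriv: "\<And>p t. ((\<lambda>t. g (p + t *\<^sub>R X)) has_real_derivative g' (p + t *\<^sub>R X)) (at t)"
    and cont: "continuous_on UNIV g" "continuous_on UNIV g'"
    and X: "norm X \<le> 1"
    and decay: "((\<lambda>p. norm p ^ (DIM('a) - 1) * g p) \<longlongrightarrow> 0) at_infinity"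
  shows "((\<lambda>r. LINT p:cball 0 r|lborel. g' p) \<longlongrightarrow> 0) at_top"
proof (rule tendstoI)
  fix e :: real assume e: "e > 0"
  define m where "m = DIM('a) - 1"
  define K where "K = 2 * DIM('a) * unit_ball_vol DIM('a) * 2 ^ m"
  have K: "K > 0" by (simp add: K_def)
  define d where "d = e / (2 * K)"
  have d: "d > 0" using e K by (simp add: d_def)
  obtain R where R: "\<And>p. R \<le> norm p \<Longrightarrow> \<bar>norm p ^ m * g p\<bar> < d"
    using tendstoD[OF decay d] by (auto simp: eventually_at_infinity m_def)
  have "\<bar>LINT p:cball 0 r|lborel. g' p\<bar> < e" if r: "r \<ge> max 1 (2 * R)" for r
  proof -
    have r0: "r > 0" using r by simp
    \<comment> \<open>Outside the ball of half the radius, the decay bounds \<open>g\<close> by \<open>d / (r / 2) ^ m\<close>;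
      halving the radius costs only the factor \<open>2 ^ m\<close> in \<open>K\<close>.\<close>
    have "\<bar>LINT p:cball 0 r|lborel. g' p\<bar>
        \<le> (d / (r / 2) ^ m) * (2 * DIM('a) * unit_ball_vol DIM('a) * r ^ (DIM('a) - 1))"
    proof (rule integral_directional_derivative_cball_le[OF deriv cont X, of "r / 2"])
      fix p :: 'a assume p: "r / 2 \<le> norm p"
      have "(r / 2) ^ m * \<bar>g p\<bar> \<le> norm p ^ m * \<bar>g p\<bar>"
        using p r0 by (intro mult_right_mono power_mono) auto
      also have "\<dots> \<le> d" using R[of p] p r by (simp add: abs_mult)
      finally show "\<bar>g p\<bar> \<le> d / (r / 2) ^ m"
        using r0 by (simp add: field_simps)
    qed (use r0 in auto)
    also have "\<dots> = d * K"
      using r0 unfolding m_def[symmetric] by (simp add: K_def power_divide)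
    also have "\<dots> < e" using e K by (simp add: d_def)
    finally show ?thesis .
  qed
  then show "\<forall>\<^sub>F r in at_top. dist (LINT p:cball 0 r|lborel. g' p) 0 < e"
    by (auto simp: eventually_at_top_linorder intro!: exI[of _ "max 1 (2 * R)"])
qed

text \<open>
  The integrals increase with the radius, so a limit \<open>0\<close> forces each of them to be \<open>0\<close>.
\<close>

lemma nonneg_continuous_eq_0_if_integral_cball_tendsto_0:
  fixes g :: "'a::euclidean_space \<Rightarrow> real"
  assumes cont: "continuous_on UNIV g" and nonneg: "\<And>p. 0 \<le> g p"
    and lim: "((\<lambda>r. LINT p:cball 0 r|lborel. g p) \<longlongrightarrow> 0) at_top"
  shows "g p = 0"
proof -
  define r where "r = norm p + 1"
  let ?I = "\<lambda>r. LINT p:cball 0 r|lborel. g p"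
  have int: "set_integrable lborel (cball 0 r) g" for r
    unfolding set_integrable_def
    by (intro borel_integrable_compact continuous_on_subset[OF cont]) auto
  have "?I r \<le> ?I r'" if "r \<le> r'" for r'
    using int[of r] int[of r'] that nonneg
    unfolding set_lebesgue_integral_def set_integrable_def
    by (intro integral_mono) (auto simp: indicator_def)
  then have "?I r \<le> 0"
    by (intro tendsto_lowerbound[OF lim]) (auto simp: eventually_at_top_linorder)
  moreover have "0 \<le> ?I r"
    unfolding set_lebesgue_integral_def by (intro integral_nonneg_AE) (auto simp: nonneg)
  ultimately have "integral (cball 0 r) g = 0"
    using set_borel_integral_eq_integral(2)[OF int[of r]] by simp
  then have "(g has_integral 0) (cball 0 r)"
    using set_borel_integral_eq_integral(1)[OF int[of r]] by (metis integrable_integral)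
  moreover have "0 < r" by (simp add: r_def add_nonneg_pos)
  ultimately show ?thesis
    by (intro has_integral_0_closure_imp_0[of "ball 0 r" g p])
       (auto simp: nonneg emeasure_cball emeasure_ball r_def intro: continuous_on_subset[OF cont])
qed

section \<open>Symmetry of mixed directional derivatives\<close>

text \<open>
  The second difference over a parallelogram does not depend on the order of its two sides. Applying
  the mean value theorem once along each side expresses it through a mixed derivative, in
  whichever order is chosen; comparing both orders on shrinking parallelograms gives the symmetry.
\<close>

lemma mixed_difference_mean_value:
  fixes f fX fXY :: "'a::real_normed_vector \<Rightarrow> real"
  assumes dX: "\<And>p t. ((\<lambda>t. f (p + t *\<^sub>R X)) has_real_derivative fX (p + t *\<^sub>R X)) (at t)"
    and dXY: "\<And>p t. ((\<lambda>t. fX (p + t *\<^sub>R Y)) has_real_derivative fXY (p + t *\<^sub>R Y)) (at t)"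
    and h: "0 < (h::real)"
  shows "\<exists>s t. 0 < s \<and> s < h \<and> 0 < t \<and> t < h \<and>
    f (p + h *\<^sub>R X + h *\<^sub>R Y) - f (p + h *\<^sub>R X) - f (p + h *\<^sub>R Y) + f p
      = h\<^sup>2 * fXY (p + s *\<^sub>R X + t *\<^sub>R Y)"
proof -
  have "((\<lambda>s. f (p + h *\<^sub>R Y + s *\<^sub>R X) - f (p + s *\<^sub>R X))
      has_real_derivative fX (p + h *\<^sub>R Y + s *\<^sub>R X) - fX (p + s *\<^sub>R X)) (at s)" for s
    by (intro DERIV_diff dX)
  from MVT2[OF h this] obtain s where s: "0 < s" "s < h"
    "f (p + h *\<^sub>R Y + h *\<^sub>R X) - f (p + h *\<^sub>R X) - (f (p + h *\<^sub>R Y + 0 *\<^sub>R X) - f (p + 0 *\<^sub>R X))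
      = (h - 0) * (fX (p + h *\<^sub>R Y + s *\<^sub>R X) - fX (p + s *\<^sub>R X))" by blast
  obtain t where t: "0 < t" "t < h"
    "fX (p + s *\<^sub>R X + h *\<^sub>R Y) - fX (p + s *\<^sub>R X + 0 *\<^sub>R Y) = (h - 0) * fXY (p + s *\<^sub>R X + t *\<^sub>R Y)"
    using MVT2[OF h dXY[of "p + s *\<^sub>R X"]] by blast
  have "f (p + h *\<^sub>R X + h *\<^sub>R Y) - f (p + h *\<^sub>R X) - f (p + h *\<^sub>R Y) + f p
      = h * (fX (p + s *\<^sub>R X + h *\<^sub>R Y) - fX (p + s *\<^sub>R X))"
    using s(3) by (simp add: add_ac algebra_simps)
  also have "\<dots> = h\<^sup>2 * fXY (p + s *\<^sub>R X + t *\<^sub>R Y)"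
    using t(3) by (simp add: power2_eq_square)
  finally show ?thesis using s t by blast
qed

lemma mixed_directional_derivatives_symmetric:
  fixes f :: "'a::real_normed_vector \<Rightarrow> real"
  assumes dX: "\<And>p t. ((\<lambda>t. f (p + t *\<^sub>R X)) has_real_derivative fX (p + t *\<^sub>R X)) (at t)"
    and dXY: "\<And>p t. ((\<lambda>t. fX (p + t *\<^sub>R Y)) has_real_derivative fXY (p + t *\<^sub>R Y)) (at t)"
    and dY: "\<And>p t. ((\<lambda>t. f (p + t *\<^sub>R Y)) has_real_derivative fY (p + t *\<^sub>R Y)) (at t)"
    and dYX: "\<And>p t. ((\<lambda>t. fY (p + t *\<^sub>R X)) has_real_derivative fYX (p + t *\<^sub>R X)) (at t)"
    and cont: "isCont fXY p" "isCont fYX p"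
  shows "fXY p = fYX p"
proof -
  define h where "h k = inverse (real (Suc k))" for k
  have h_pos: "0 < h k" for k by (simp add: h_def)
  have h_lim: "h \<longlonglongrightarrow> 0"
    unfolding h_def by (rule LIMSEQ_inverse_real_of_nat)
  have "\<exists>s t s' t'. 0 < s \<and> s < h k \<and> 0 < t \<and> t < h k \<and> 0 < s' \<and> s' < h k \<and> 0 < t' \<and> t' < h k \<and>
      fXY (p + s *\<^sub>R X + t *\<^sub>R Y) = fYX (p + s' *\<^sub>R Y + t' *\<^sub>R X)" for k
  proof -
    obtain s t where st: "0 < s" "s < h k" "0 < t" "t < h k"
      "f (p + h k *\<^sub>R X + h k *\<^sub>R Y) - f (p + h k *\<^sub>R X) - f (p + h k *\<^sub>R Y) + f p
        = (h k)\<^sup>2 * fXY (p + s *\<^sub>R X + t *\<^sub>R Y)"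
      using mixed_difference_mean_value[OF dX dXY h_pos] by blast
    obtain s' t' where st': "0 < s'" "s' < h k" "0 < t'" "t' < h k"
      "f (p + h k *\<^sub>R Y + h k *\<^sub>R X) - f (p + h k *\<^sub>R Y) - f (p + h k *\<^sub>R X) + f p
        = (h k)\<^sup>2 * fYX (p + s' *\<^sub>R Y + t' *\<^sub>R X)"
      using mixed_difference_mean_value[OF dY dYX h_pos] by blast
    have "(h k)\<^sup>2 * fXY (p + s *\<^sub>R X + t *\<^sub>R Y) = (h k)\<^sup>2 * fYX (p + s' *\<^sub>R Y + t' *\<^sub>R X)"
      using st(5) st'(5) by (simp add: add_ac diff_diff_eq)
    with h_pos[of k] have "fXY (p + s *\<^sub>R X + t *\<^sub>R Y) = fYX (p + s' *\<^sub>R Y + t' *\<^sub>R X)"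
      by simp
    with st st' show ?thesis by blast
  qed
  then obtain s t s' t' where
    s: "\<And>k. 0 < s k" "\<And>k. s k < h k" and t: "\<And>k. 0 < t k" "\<And>k. t k < h k" and
    s': "\<And>k. 0 < s' k" "\<And>k. s' k < h k" and t': "\<And>k. 0 < t' k" "\<And>k. t' k < h k" and
    eq: "\<And>k. fXY (p + s k *\<^sub>R X + t k *\<^sub>R Y) = fYX (p + s' k *\<^sub>R Y + t' k *\<^sub>R X)"
    by metis
  have small: "u \<longlonglongrightarrow> 0" if "\<And>k. 0 < u k" "\<And>k. u k < h k" for u :: "nat \<Rightarrow> real"
    by (rule tendsto_sandwich[OF _ _ tendsto_const h_lim])
       (use that in \<open>auto intro!: always_eventually less_imp_le\<close>)
  have "(\<lambda>k. p + s k *\<^sub>R X + t k *\<^sub>R Y) \<longlonglongrightarrow> p + 0 *\<^sub>R X + 0 *\<^sub>R Y"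
    by (intro tendsto_intros small s t)
  then have "(\<lambda>k. fXY (p + s k *\<^sub>R X + t k *\<^sub>R Y)) \<longlonglongrightarrow> fXY p"
    using isCont_tendsto_compose[OF cont(1)] by simp
  moreover have "(\<lambda>k. p + s' k *\<^sub>R Y + t' k *\<^sub>R X) \<longlonglongrightarrow> p + 0 *\<^sub>R Y + 0 *\<^sub>R X"
    by (intro tendsto_intros small s' t')
  then have "(\<lambda>k. fYX (p + s' k *\<^sub>R Y + t' k *\<^sub>R X)) \<longlonglongrightarrow> fYX p"
    using isCont_tendsto_compose[OF cont(2)] by simp
  ultimately show ?thesis
    unfolding eq by (rule LIMSEQ_unique)
qed

section \<open>Directional derivatives of functions on the plane\<close>

lemma C1_GDERIV: "C1 f \<Longrightarrow> GDERIV f p :> grad f p"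
  by (simp add: C1_def GDERIV_grad)

lemma C1I:
  assumes "\<And>p. GDERIV f p :> D p" "continuous_on UNIV D"
  shows "C1 f"
proof -
  have "grad f = D" using grad_eqI[OF assms(1)] by auto
  moreover have "f differentiable (at p)" for p
    using assms(1)[of p] unfolding gderiv_def differentiable_def by blast
  ultimately show ?thesis using assms(2) by (simp add: C1_def)
qed

lemma C1_continuous: "C1 f \<Longrightarrow> continuous_on UNIV f"
  by (auto simp: C1_def intro!: differentiable_imp_continuous_on
      simp: differentiable_on_def differentiable_at_withinI)

lemma C1_continuous_grad: "C1 f \<Longrightarrow> continuous_on UNIV (grad f)"
  by (simp add: C1_def)

lemma C1_continuous_dir_deriv: "C1 f \<Longrightarrow> continuous_on UNIV (dir_deriv X f)"
  unfolding dir_deriv_def[abs_def] by (intro continuous_intros C1_continuous_grad)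

lemma C1_const: "C1 (\<lambda>p. c)"
  by (rule C1I[OF GDERIV_const]) simp

lemma C1_add: "C1 f \<Longrightarrow> C1 g \<Longrightarrow> C1 (\<lambda>p. f p + g p)"
  by (rule C1I[OF GDERIV_add[OF C1_GDERIV C1_GDERIV]])
     (auto intro!: continuous_intros C1_continuous_grad)

lemma C1_mult: "C1 f \<Longrightarrow> C1 g \<Longrightarrow> C1 (\<lambda>p. f p * g p)"
  by (rule C1I[OF GDERIV_mult[OF C1_GDERIV C1_GDERIV]])
     (auto intro!: continuous_intros C1_continuous_grad C1_continuous)

lemma dir_deriv_along_line:
  assumes "C1 f"
  shows "((\<lambda>t. f (p + t *\<^sub>R X)) has_real_derivative dir_deriv X f (p + t *\<^sub>R X)) (at t)"
proof -
  have f: "(f has_derivative (\<lambda>h. h \<bullet> grad f (p + t *\<^sub>R X))) (at (p + t *\<^sub>R X))"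
    using C1_GDERIV[OF assms] by (simp add: gderiv_def)
  have "((\<lambda>t. p + t *\<^sub>R X) has_derivative (\<lambda>h. h *\<^sub>R X)) (at t)"
    by (auto intro!: derivative_eq_intros)
  from has_derivative_compose[OF this f] show ?thesis
    by (simp add: has_field_derivative_def dir_deriv_def inner_commute mult_commute_abs)
qed

lemma C2_imp_C1_dir_deriv:
  assumes "C2 f"
  shows "C1 (dir_deriv X f)"
proof -
  have "C1 (\<lambda>p. grad f p $ 1 * X $ 1 + grad f p $ 2 * X $ 2)"
    using assms by (intro C1_add C1_mult C1_const) (auto simp: C2_def)
  moreover have "dir_deriv X f = (\<lambda>p. grad f p $ 1 * X $ 1 + grad f p $ 2 * X $ 2)"
    by (auto simp: dir_deriv_def inner_vec_def sum_2)
  ultimately show ?thesis by simp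
qed

lemma C2_imp_dir_deriv_commute:
  assumes "C2 f"
  shows "dir_deriv X (dir_deriv Y f) p = dir_deriv Y (dir_deriv X f) p"
proof -
  have f: "C1 f" using assms by (simp add: C2_def)
  note C1 = C2_imp_C1_dir_deriv[OF assms]
  have cont: "isCont (dir_deriv Z (dir_deriv W f)) p" for Z W
    using C1_continuous_dir_deriv[OF C1] by (simp add: continuous_on_eq_continuous_at)
  show ?thesis
    by (rule mixed_directional_derivatives_symmetric[OF
          dir_deriv_along_line[OF f] dir_deriv_along_line[OF C1]
          dir_deriv_along_line[OF f] dir_deriv_along_line[OF C1] cont cont])
qed

text \<open>
  The weighted curvature difference is the divergence of
  \<open>f\<^sub>X (1 + f\<^sub>Y\<^sup>2) X - f\<^sub>Y (1 + f\<^sub>X\<^sup>2) Y\<close>. Up to sign, the two coefficients of this vector field are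
  the same expression with \<open>X\<close> and \<open>Y\<close> exchanged, so it suffices to treat the first one.
\<close>

lemma C1_flux_component:
  assumes "C2 f"
  shows "C1 (\<lambda>p. dir_deriv X f p * (1 + dir_deriv Y f p * dir_deriv Y f p))"
  by (intro C1_add C1_mult C1_const C2_imp_C1_dir_deriv assms)

lemma dir_deriv_flux_component:
  assumes "C2 f"
  shows "dir_deriv Z (\<lambda>p. dir_deriv X f p * (1 + dir_deriv Y f p * dir_deriv Y f p)) p =
    dir_deriv Z (dir_deriv X f) p * (1 + (dir_deriv Y f p)\<^sup>2)
      + 2 * dir_deriv X f p * dir_deriv Y f p * dir_deriv Z (dir_deriv Y f) p"
proof -
  note D = C1_GDERIV[OF C2_imp_C1_dir_deriv[OF assms]]
  show ?thesis
    by (simp only: dir_deriv_def[of Z] grad_eqI[OF GDERIV_mult[OF D GDERIV_add[OF GDERIV_const GDERIV_mult[OF D D]]]]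
          inner_add_left inner_zero_left inner_scaleR_left power2_eq_square)
       (simp add: algebra_simps)
qed

text \<open>
  Each component contributes a term \<open>2 f\<^sub>X f\<^sub>Y\<close> times a mixed derivative, one with \<open>f\<^sub>Y\<^sub>X\<close> and the
  other with \<open>f\<^sub>X\<^sub>Y\<close>, so these terms cancel.
\<close>

lemma curvature_difference_eq_divergence:
  assumes "C2 f"
  shows "dir_deriv X (dir_deriv X f) p * (1 + (dir_deriv Y f p)\<^sup>2)
      - dir_deriv Y (dir_deriv Y f) p * (1 + (dir_deriv X f p)\<^sup>2)
    = dir_deriv X (\<lambda>p. dir_deriv X f p * (1 + dir_deriv Y f p * dir_deriv Y f p)) p
      - dir_deriv Y (\<lambda>p. dir_deriv Y f p * (1 + dir_deriv X f p * dir_deriv X f p)) p"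
  unfolding dir_deriv_flux_component[OF assms]
  using C2_imp_dir_deriv_commute[OF assms, of X Y p] by (simp add: algebra_simps)

section \<open>Decay of the gradient at infinity\<close>

lemma polar_norm_surj: "\<exists>\<theta>. p = polar (norm p) \<theta>"
proof (cases "p = 0")
  case True
  then show ?thesis by (auto simp: polar_def vec_eq_iff forall_2)
next
  case False
  have "(p $ 1)\<^sup>2 + (p $ 2)\<^sup>2 = (norm p)\<^sup>2"
    unfolding power2_norm_eq_inner by (simp add: inner_vec_def sum_2 power2_eq_square)
  then have "((p $ 1)\<^sup>2 + (p $ 2)\<^sup>2) / (norm p)\<^sup>2 = 1"
    using False by simp
  then have "(p $ 1 / norm p)\<^sup>2 + (p $ 2 / norm p)\<^sup>2 = 1"
    by (simp only: power_divide add_divide_distrib)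
  then obtain t where t: "p $ 1 / norm p = cos t" "p $ 2 / norm p = sin t"
    by (rule sincos_total_2pi)
  have "p = polar (norm p) t"
    unfolding polar_def t[symmetric] using False by (simp add: vec_eq_iff forall_2)
  then show ?thesis ..
qed

lemma asymptotically_constant_imp_gradient_decay:
  assumes "asymptotically_constant f"
  shows "((\<lambda>p. norm p * norm (grad f p)) \<longlongrightarrow> 0) at_infinity"
proof (rule tendstoI)
  fix e :: real assume "e > 0"
  with assms have "\<forall>\<^sub>F r in at_top. \<forall>\<theta>. \<bar>r * norm (grad f (polar r \<theta>))\<bar> < e"
    by (auto simp: asymptotically_constant_def dest!: uniform_limitD)
  then obtain R where R: "\<And>r \<theta>. r \<ge> R \<Longrightarrow> \<bar>r * norm (grad f (polar r \<theta>))\<bar> < e"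
    by (auto simp: eventually_at_top_linorder)
  have "\<bar>norm p * norm (grad f p)\<bar> < e" if "R \<le> norm p" for p
    using R[OF that] polar_norm_surj[of p] by metis
  then show "\<forall>\<^sub>F p in at_infinity. dist (norm p * norm (grad f p)) 0 < e"
    by (auto simp: eventually_at_infinity)
qed

text \<open>
  The factor \<open>f\<^sub>X\<close> absorbs \<open>norm p\<close>, and the other factor tends to \<open>1\<close>.
\<close>

lemma flux_component_decay:
  assumes "asymptotically_constant f"
  shows "((\<lambda>p. norm p * (dir_deriv X f p * (1 + dir_deriv Y f p * dir_deriv Y f p))) \<longlongrightarrow> 0) at_infinity"
proof -
  have rG: "((\<lambda>p. norm p * norm (grad f p) * norm Z) \<longlongrightarrow> 0) at_infinity" for Z
    by (rule tendsto_mult_left_zero[OF asymptotically_constant_imp_gradient_decay[OF assms]])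
  have CS: "norm (dir_deriv Z f p) \<le> norm (grad f p) * norm Z" for Z p
    unfolding dir_deriv_def real_norm_def by (rule Cauchy_Schwarz_ineq2)
  have rD: "((\<lambda>p. norm p * dir_deriv Z f p) \<longlongrightarrow> 0) at_infinity" for Z
    by (rule Lim_null_comparison[OF _ rG[of Z]])
       (use CS in \<open>auto simp: abs_mult mult.assoc intro!: always_eventually mult_left_mono\<close>)
  have D: "((\<lambda>p. dir_deriv Z f p) \<longlongrightarrow> 0) at_infinity" for Z
  proof (rule Lim_null_comparison[OF _ tendsto_rabs_zero[OF rD[of Z]]])
    show "\<forall>\<^sub>F p in at_infinity. norm (dir_deriv Z f p) \<le> \<bar>norm p * dir_deriv Z f p\<bar>"
      by (auto simp: eventually_at_infinity abs_mult mult_le_cancel_right1 intro!: exI[of _ 1])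
  qed
  have "((\<lambda>p. (norm p * dir_deriv X f p) * (1 + dir_deriv Y f p * dir_deriv Y f p)) \<longlongrightarrow> 0 * (1 + 0 * 0)) at_infinity"
    by (intro tendsto_intros rD D)
  then show ?thesis by (simp add: mult.assoc)
qed

section \<open>Comparing normal curvatures\<close>

lemma weighted_curvature_difference:
  "(normal_curvature f p X - normal_curvature f p Y)
      * ((1 + (dir_deriv X f p)\<^sup>2) * (1 + (dir_deriv Y f p)\<^sup>2) * sqrt (1 + (norm (grad f p))\<^sup>2))
    = dir_deriv X (dir_deriv X f) p * (1 + (dir_deriv Y f p)\<^sup>2)
      - dir_deriv Y (dir_deriv Y f) p * (1 + (dir_deriv X f p)\<^sup>2)"
proof -
  have cancel: "(u / (a * s) - v / (b * s)) * (a * b * s) = u * b - v * a"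
    if "a > 0" "b > 0" "s > 0" for u v a b s :: real
    using that by (simp add: field_simps)
  show ?thesis
    unfolding normal_curvature_def by (rule cancel) (simp_all add: add_pos_nonneg)
qed

lemma set_integral_graph_area:
  assumes "C1 f" and "A \<in> sets borel" and "g \<in> borel_measurable borel"
  shows "(LINT p:A|graph_area f. g p) = (LINT p:A|lborel. g p * sqrt (1 + (norm (grad f p))\<^sup>2))"
proof -
  have [measurable]: "grad f \<in> borel_measurable borel"
    using C1_continuous_grad[OF assms(1)] by (rule borel_measurable_continuous_onI)
  have [measurable]: "A \<in> sets borel" "g \<in> borel_measurable borel" by fact+
  show ?thesis
    unfolding set_lebesgue_integral_def graph_area_def
    by (subst integral_density) (auto simp: mult_ac)
qed

section \<open>The limit of the total curvature difference\<close>

theorem theorem1p2: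
  fixes f :: "real^2 \<Rightarrow> real" and X Y :: "real^2"
  assumes "C2 f"
    and "asymptotically_constant f"
    and "X \<in> sphere 0 1" and "Y \<in> sphere 0 1"
  shows "((\<lambda>r. LINT p : cball 0 r | graph_area f.
             (normal_curvature f p X - normal_curvature f p Y)
               * (1 + (dir_deriv X f p)\<^sup>2) * (1 + (dir_deriv Y f p)\<^sup>2)) \<longlongrightarrow> 0) at_top
         \<and> ((\<forall>p. normal_curvature f p X - normal_curvature f p Y = 0)
             \<or> changes_sign (\<lambda>p. normal_curvature f p X - normal_curvature f p Y))"
proof -
  have f: "C1 f" using assms(1) by (simp add: C2_def)
  note C1 = C2_imp_C1_dir_deriv[OF assms(1)]
  define k where "k p = normal_curvature f p X - normal_curvature f p Y" for p
  define w where "w p = (1 + (dir_deriv X f p)\<^sup>2) * (1 + (dir_deriv Y f p)\<^sup>2)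
    * sqrt (1 + (norm (grad f p))\<^sup>2)" for p
  define G where "G p = dir_deriv X (dir_deriv X f) p * (1 + (dir_deriv Y f p)\<^sup>2)
      - dir_deriv Y (dir_deriv Y f) p * (1 + (dir_deriv X f p)\<^sup>2)" for p
  have G_eq: "G p = k p * w p" for p
    using weighted_curvature_difference[of f p X Y] by (simp add: G_def k_def w_def)
  have w_pos: "w p > 0" for p
    by (simp add: w_def add_pos_nonneg)
  have contG: "continuous_on UNIV G"
    unfolding G_def by (intro continuous_intros C1_continuous_dir_deriv C1 f)
  have flux: "((\<lambda>r. LINT p:cball 0 r|lborel.
      dir_deriv Z (\<lambda>p. dir_deriv Z f p * (1 + dir_deriv W f p * dir_deriv W f p)) p) \<longlongrightarrow> 0) at_top"
    if "Z \<in> sphere 0 1" for Z W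
    using that flux_component_decay[OF assms(2), of Z W]
    by (intro integral_directional_derivative_cball_tendsto_0[OF dir_deriv_along_line]
          C1_continuous C1_continuous_dir_deriv C1_flux_component assms(1)) auto
  have int: "set_integrable lborel (cball 0 r) (dir_deriv Z (\<lambda>p. dir_deriv Z f p * (1 + dir_deriv W f p * dir_deriv W f p)))" for r Z W
    unfolding set_integrable_def
    by (intro borel_integrable_compact continuous_on_subset[OF C1_continuous_dir_deriv[OF C1_flux_component[OF assms(1)]]]) auto
  have limG: "((\<lambda>r. LINT p:cball 0 r|lborel. G p) \<longlongrightarrow> 0) at_top"
    using tendsto_diff[OF flux[OF assms(3), of Y] flux[OF assms(4), of X]]
    unfolding G_def curvature_difference_eq_divergence[OF assms(1)]
    by (simp add: set_integral_diff[OF int int])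
  have "(LINT p : cball 0 r | graph_area f. k p * (1 + (dir_deriv X f p)\<^sup>2) * (1 + (dir_deriv Y f p)\<^sup>2))
      = (LINT p:cball 0 r|lborel. G p)" for r
  proof -
    have "continuous_on UNIV (\<lambda>p. G p / sqrt (1 + (norm (grad f p))\<^sup>2))"
      by (intro continuous_intros contG C1_continuous_grad f) (auto simp: add_pos_nonneg add_nonneg_eq_0_iff)
    moreover have "k p * (1 + (dir_deriv X f p)\<^sup>2) * (1 + (dir_deriv Y f p)\<^sup>2)
        = G p / sqrt (1 + (norm (grad f p))\<^sup>2)" for p
      unfolding G_eq w_def by (simp add: add_nonneg_eq_0_iff)
    ultimately have meas: "(\<lambda>p. k p * (1 + (dir_deriv X f p)\<^sup>2) * (1 + (dir_deriv Y f p)\<^sup>2)) \<in> borel_measurable borel"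
      by (simp add: borel_measurable_continuous_onI)
    have "k p * (1 + (dir_deriv X f p)\<^sup>2) * (1 + (dir_deriv Y f p)\<^sup>2)
        * sqrt (1 + (norm (grad f p))\<^sup>2) = G p" for p
      by (simp only: G_eq w_def mult.assoc)
    then show ?thesis
      by (simp only: set_integral_graph_area[OF f borel_closed[OF closed_cball] meas])
  qed
  with limG have lim: "((\<lambda>r. LINT p : cball 0 r | graph_area f.
      k p * (1 + (dir_deriv X f p)\<^sup>2) * (1 + (dir_deriv Y f p)\<^sup>2)) \<longlongrightarrow> 0) at_top"
    by simp
  have "k p = 0" if "\<not> changes_sign k" for p
  proof -
    from that consider "\<And>p. 0 \<le> k p" | "\<And>p. k p \<le> 0"
      unfolding changes_sign_def by (meson not_le)
    then have "G p = 0"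
    proof cases
      case 1
      then show ?thesis
        using w_pos
        by (intro nonneg_continuous_eq_0_if_integral_cball_tendsto_0[OF contG _ limG])
           (auto simp: G_eq less_imp_le)
    next
      case 2
      have "- G p = 0"
      proof (rule nonneg_continuous_eq_0_if_integral_cball_tendsto_0[where g = "\<lambda>p. - G p"])
        show "continuous_on UNIV (\<lambda>p. - G p)" by (intro continuous_intros contG)
        show "0 \<le> - G p" for p
          using 2 w_pos by (auto simp: G_eq mult_nonpos_nonneg less_imp_le)
        show "((\<lambda>r. LINT p:cball 0 r|lborel. - G p) \<longlongrightarrow> 0) at_top"
          using tendsto_minus[OF limG] by (simp add: set_lebesgue_integral_def)
      qed
      then show ?thesis by simp
    qed
    then show ?thesis using w_pos[of p] by (simp add: G_eq)
  qed
  with lim show ?thesis unfolding k_def by blast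
qed

end
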